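(* In the pure bang calculus $(\Lambda_!,\to_{!\beta})$, $\to_{\ell\ell,!\beta}$ is a normalizing strategy for $\to_{!\beta}$: it has the same normal forms as $\to_{!\beta}$, and whenever $T\to_{!\beta}^* U$ with $U$ $!\beta$-normal, every maximal $\to_{\ell\ell,!\beta}$-sequence from $T$ ends in a $!\beta$-normal form.
   Context: Pure bang terms: $T ::= x\mid\lambda x.T\mid TS\mid !T$ (set $\Lambda_!$), contexts $C ::= [\cdot]\mid\lambda x.C\mid TC\mid CT\mid !C$. $\to_{!\beta}$ is the contextual closure of $(\lambda x.T)\,!S\mapsto_{!\beta}T[S/x]$. Level: $\mathrm{lev}([\cdot])=0$, $\mathrm{lev}(!C)=\mathrm{lev}(C)+1$, unchanged under $\lambda$ and application. $\mathrm{ll}(T)=\inf\{\mathrm{lev}(C)\mid T=C[R], R\text{ a }!\beta\text{-redex}\}$. A step $C[R]\to_{!\beta}C[R']$ is least-level ($\to_{\ell\ell,!\beta}$) if $\mathrm{lev}(C)=\mathrm{ll}(C[R])$. *)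

theory Defs
  imports Main "HOL-Library.Extended_Nat"
begin

text \<open>Terms up to \<open>\<alpha>\<close>-equivalence are represented with de Bruijn indices.\<close>

datatype bterm =
    Var nat
  | Lam bterm
  | App bterm bterm
  | Bang bterm

datatype bctx =
    Hole
  | CLam bctx
  | CAppR bterm bctx
  | CAppL bctx bterm
  | CBang bctx

text \<open>Plugging may capture: the indices of the plugged term are not shifted under \<open>CLam\<close>.\<close>

primrec plug :: "bctx \<Rightarrow> bterm \<Rightarrow> bterm" where
  "plug Hole R = R"
| "plug (CLam C) R = Lam (plug C R)"
| "plug (CAppR T C) R = App T (plug C R)"
| "plug (CAppL C T) R = App (plug C R) T"
| "plug (CBang C) R = Bang (plug C R)"

primrec lev :: "bctx \<Rightarrow> nat" where
  "lev Hole = 0"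
| "lev (CLam C) = lev C"
| "lev (CAppR T C) = lev C"
| "lev (CAppL C T) = lev C"
| "lev (CBang C) = lev C + 1"

primrec lift :: "nat \<Rightarrow> bterm \<Rightarrow> bterm" where
  "lift k (Var i) = (if i < k then Var i else Var (i + 1))"
| "lift k (Lam T) = Lam (lift (k + 1) T)"
| "lift k (App T S) = App (lift k T) (lift k S)"
| "lift k (Bang T) = Bang (lift k T)"

text \<open>
  \<open>subst T S k\<close> replaces index \<open>k\<close> by \<open>S\<close> and decrements the indices above \<open>k\<close>, because
  the binder of \<open>k\<close> disappears when a redex is contracted.
\<close>

primrec subst :: "bterm \<Rightarrow> bterm \<Rightarrow> nat \<Rightarrow> bterm" where
  "subst (Var i) S k = (if i = k then S else if k < i then Var (i - 1) else Var i)"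
| "subst (Lam T) S k = Lam (subst T (lift 0 S) (k + 1))"
| "subst (App T U) S k = App (subst T S k) (subst U S k)"
| "subst (Bang T) S k = Bang (subst T S k)"

inductive bang_root :: "bterm \<Rightarrow> bterm \<Rightarrow> bool" where
  "bang_root (App (Lam T) (Bang S)) (subst T S 0)"

definition is_redex :: "bterm \<Rightarrow> bool" where
  "is_redex R \<longleftrightarrow> (\<exists>R'. bang_root R R')"

definition bang_step :: "bterm \<Rightarrow> bterm \<Rightarrow> bool" where
  "bang_step T U \<longleftrightarrow> (\<exists>C R R'. T = plug C R \<and> U = plug C R' \<and> bang_root R R')"

text \<open>The infimum is taken in \<open>enat\<close>, so \<open>ll T = \<infinity>\<close> when \<open>T\<close> contains no redex.\<close>

definition ll :: "bterm \<Rightarrow> enat" where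
  "ll T = Inf {enat (lev C) | C R. T = plug C R \<and> is_redex R}"

definition ll_step :: "bterm \<Rightarrow> bterm \<Rightarrow> bool" where
  "ll_step T U \<longleftrightarrow>
     (\<exists>C R R'. T = plug C R \<and> U = plug C R' \<and> bang_root R R' \<and> enat (lev C) = ll T)"

definition normal :: "('a \<Rightarrow> 'a \<Rightarrow> bool) \<Rightarrow> 'a \<Rightarrow> bool" where
  "normal r x \<longleftrightarrow> \<not> (\<exists>y. r x y)"

text \<open>
  A reduction sequence is given by its number of steps \<open>n\<close>, possibly \<open>\<infinity>\<close>, and a function
  \<open>s\<close> of which only the values at indices \<open>i \<le> n\<close> matter. It is maximal if it cannot be
  extended; infinite sequences are always maximal.
\<close>

definition red_seq :: "('a \<Rightarrow> 'a \<Rightarrow> bool) \<Rightarrow> (nat \<Rightarrow> 'a) \<Rightarrow> enat \<Rightarrow> bool" where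
  "red_seq r s n \<longleftrightarrow> (\<forall>i. enat i < n \<longrightarrow> r (s i) (s (Suc i)))"

definition maximal_red_seq :: "('a \<Rightarrow> 'a \<Rightarrow> bool) \<Rightarrow> (nat \<Rightarrow> 'a) \<Rightarrow> enat \<Rightarrow> bool" where
  "maximal_red_seq r s n \<longleftrightarrow>
     red_seq r s n \<and> (\<forall>k. n = enat k \<longrightarrow> \<not> (\<exists>y. r (s k) y))"

definition normalizing_strategy :: "('a \<Rightarrow> 'a \<Rightarrow> bool) \<Rightarrow> ('a \<Rightarrow> 'a \<Rightarrow> bool) \<Rightarrow> bool" where
  "normalizing_strategy e r \<longleftrightarrow>
     (\<forall>x y. e x y \<longrightarrow> r x y) \<and>
     (\<forall>x. normal e x \<longleftrightarrow> normal r x) \<and>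
     (\<forall>x u. r\<^sup>*\<^sup>* x u \<and> normal r u \<longrightarrow>
        (\<forall>s n. s 0 = x \<and> maximal_red_seq e s n \<longrightarrow> (\<exists>k. n = enat k \<and> normal r (s k))))"

end

theory Submission
  imports Defs
begin

text \<open>
  Three facts about redexes graded by their level carry the proof.
  Contractions at levels \<open>> m\<close> neither create nor destroy redexes at levels \<open>\<le> m\<close>, so a parallel
  step above level \<open>m\<close> followed by a step at level \<open>m\<close> is again a parallel step.
  A parallel step at levels \<open>\<ge> m\<close> factors into steps at level exactly \<open>m\<close> followed by a parallel
  step above \<open>m\<close> (Takahashi's method). Together they show that least-level normalizability is
  preserved by backward parallel steps.
  Finally, two different steps at the same level close in one step at that level, because a redex
  of level 0 can neither erase nor duplicate another one of level 0; hence all maximal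
  least-level sequences from a term have the same length.
\<close>

section \<open>Lifting and substitution\<close>

lemma lift_lift:
  "i < k + 1 \<Longrightarrow> lift (Suc k) (lift i t) = lift i (lift k t)"
  by (induction t arbitrary: i k) auto

lemma lift_subst:
  "j < i + 1 \<Longrightarrow> lift i (subst t s j) = subst (lift (i + 1) t) (lift i s) j"
  by (induction t arbitrary: i j s) (auto simp: lift_lift split: nat.split)

lemma lift_subst_lt:
  "i < j + 1 \<Longrightarrow> lift i (subst t s j) = subst (lift i t) (lift i s) (j + 1)"
  by (induction t arbitrary: i j s) (auto simp: lift_lift)

lemma subst_lift [simp]: "subst (lift k t) s k = t"
  by (induction t arbitrary: k s) auto

text \<open>The classical substitution lemma in de Bruijn form; it lets root contraction commute
  with substitution.\<close>

lemma subst_subst: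
  "i < j + 1 \<Longrightarrow>
    subst (subst t (lift i v) (Suc j)) (subst u v j) i = subst (subst t u i) v j"
proof (induction t arbitrary: i j u v)
  case (Lam t)
  then show ?case
    using Lam.IH[of "Suc i" "Suc j" "lift 0 v" "lift 0 u"]
    by (simp add: lift_lift[symmetric] lift_subst_lt)
qed auto

section \<open>Steps graded by level\<close>

text \<open>Contextual closure indexed by the level of the hole, so that rule induction replaces
  reasoning about contexts.\<close>

inductive step :: "nat \<Rightarrow> bterm \<Rightarrow> bterm \<Rightarrow> bool" where
  beta: "step 0 (App (Lam T) (Bang S)) (subst T S 0)"
| lam: "step m T T' \<Longrightarrow> step m (Lam T) (Lam T')"
| appL: "step m T T' \<Longrightarrow> step m (App T S) (App T' S)"
| appR: "step m S S' \<Longrightarrow> step m (App T S) (App T S')"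
| bang: "step m T T' \<Longrightarrow> step (Suc m) (Bang T) (Bang T')"

inductive_cases step_LamE: "step m (Lam T) U"
inductive_cases step_AppE: "step m (App T S) U"
inductive_cases step_BangE: "step m (Bang T) U"

lemma step_iff_plug:
  "step m T U \<longleftrightarrow> (\<exists>C R R'. T = plug C R \<and> U = plug C R' \<and> bang_root R R' \<and> lev C = m)"
proof
  assume "step m T U"
  then show "\<exists>C R R'. T = plug C R \<and> U = plug C R' \<and> bang_root R R' \<and> lev C = m"
  proof induction
    case (beta T S)
    then show ?case by (metis bang_root.intros lev.simps(1) plug.simps(1))
  next
    case (lam m T T')
    then show ?case by (metis lev.simps(2) plug.simps(2))
  next
    case (appL m T T' S)
    then show ?case by (metis lev.simps(4) plug.simps(4))
  next
    case (appR m S S' T)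
    then show ?case by (metis lev.simps(3) plug.simps(3))
  next
    case (bang m T T')
    then show ?case by (metis Suc_eq_plus1 lev.simps(5) plug.simps(5))
  qed
next
  have "bang_root R R' \<Longrightarrow> step (lev C) (plug C R) (plug C R')" for C R R'
    by (induction C) (auto intro: step.intros elim: bang_root.cases)
  then show "\<exists>C R R'. T = plug C R \<and> U = plug C R' \<and> bang_root R R' \<and> lev C = m \<Longrightarrow> step m T U"
    by blast
qed

lemma bang_step_iff: "bang_step T U \<longleftrightarrow> (\<exists>m. step m T U)"
  by (auto simp: bang_step_def step_iff_plug)

text \<open>For a step at level \<open>m\<close>, this expresses that \<open>m\<close> is the least
  level without an infimum in \<open>enat\<close>.\<close>

definition free_below :: "nat \<Rightarrow> bterm \<Rightarrow> bool" where
  "free_below m T \<longleftrightarrow> (\<forall>j<m. normal (step j) T)"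

lemma ll_eq: "ll T = Inf {enat m | m. \<not> normal (step m) T}"
  unfolding ll_def is_redex_def normal_def step_iff_plug
  by (rule arg_cong[of _ _ Inf]) blast

lemma ll_step_iff: "ll_step T U \<longleftrightarrow> (\<exists>m. step m T U \<and> free_below m T)"
proof -
  have "enat m = ll T \<longleftrightarrow> free_below m T" if s: "step m T U" for m
  proof
    assume "enat m = ll T"
    then have "enat m \<le> enat j" if "\<not> normal (step j) T" for j
      unfolding ll_eq using that by (auto intro: Inf_lower)
    then show "free_below m T"
      unfolding free_below_def by (metis enat_ord_simps(1) not_le)
  next
    assume f: "free_below m T"
    show "enat m = ll T"
      unfolding ll_eq
    proof (rule antisym)
      show "enat m \<le> Inf {enat m |m. \<not> normal (step m) T}"
        using f by (intro Inf_greatest) (auto simp: free_below_def intro: leI)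
      show "Inf {enat m |m. \<not> normal (step m) T} \<le> enat m"
        using s by (intro Inf_lower) (auto simp: normal_def)
    qed
  qed
  moreover have "ll_step T U \<longleftrightarrow> (\<exists>m. step m T U \<and> enat m = ll T)"
    unfolding ll_step_def step_iff_plug by auto
  ultimately show ?thesis by blast
qed

lemma normal_ll_step_iff: "normal ll_step T \<longleftrightarrow> normal bang_step T"
proof
  assume n: "normal ll_step T"
  have "\<not> step m T U" for m U
  proof (induction m arbitrary: U rule: less_induct)
    case (less m)
    then have "free_below m T" by (simp add: free_below_def normal_def)
    then show ?case using n by (auto simp: normal_def ll_step_iff)
  qed
  then show "normal bang_step T" by (simp add: normal_def bang_step_iff)
qed (auto simp: normal_def bang_step_iff ll_step_iff)

lemma step_lift: "step m T T' \<Longrightarrow> step m (lift k T) (lift k T')"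
proof (induction arbitrary: k rule: step.induct)
  case (beta T S)
  show ?case using step.beta[of "lift (k + 1) T" "lift k S"] by (simp add: lift_subst)
qed (auto intro: step.intros)

lemma step_subst: "step m T T' \<Longrightarrow> step m (subst T S k) (subst T' S k)"
proof (induction arbitrary: k S rule: step.induct)
  case (beta T U)
  show ?case
    using step.beta[of "subst T (lift 0 S) (Suc k)" "subst U S k"] by (simp add: subst_subst)
qed (auto intro: step.intros)

text \<open>The argument of a level-0 redex sits under a bang, so contraction copies or erases no
  other level-0 redex. The only overlap is with a redex in the body, which survives by
  \<open>step_subst\<close>.\<close>

lemma step_diamond:
  assumes "step m T U" "step m T V" "U \<noteq> V"
  shows "\<exists>W. step m U W \<and> step m V W"
  using assms
proof (induction arbitrary: V rule: step.induct)
  case (beta T S)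
  then show ?case
    by (auto elim!: step_AppE step_LamE step_BangE intro: step.intros step_subst)
next
  case (lam m T T')
  then show ?case by (elim step_LamE) (metis step.lam)
next
  case (appL m T T' S)
  from appL.prems(1) consider
      (beta) A B where "m = 0" "T = Lam A" "S = Bang B" "V = subst A B 0"
    | (left) A where "V = App A S" "step m T A"
    | (right) B where "V = App T B" "step m S B"
    by (rule step_AppE)
  then show ?case
  proof cases
    case beta
    then obtain A' where "T' = Lam A'" "step m A A'"
      using appL.hyps by (auto elim: step_LamE)
    then show ?thesis using beta by (auto intro: step.beta step_subst)
  next
    case left
    then show ?thesis using appL.IH appL.prems(2) by (metis step.appL)
  next
    case right
    then show ?thesis using appL.hyps by (metis step.appL step.appR)
  qed
next
  case (appR m S S' T)
  from appR.prems(1) consider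
      (beta) B where "m = 0" "S = Bang B"
    | (left) A where "V = App A S" "step m T A"
    | (right) B where "V = App T B" "step m S B"
    by (rule step_AppE)
  then show ?case
  proof cases
    case beta
    then show ?thesis using appR.hyps by (auto elim: step_BangE)
  next
    case left
    then show ?thesis using appR.hyps by (metis step.appL step.appR)
  next
    case right
    then show ?thesis using appR.IH appR.prems(2) by (metis step.appR)
  qed
next
  case (bang m T T')
  then show ?case by (elim step_BangE) (metis step.bang nat.inject)
qed

lemma
  assumes "(step m)\<^sup>*\<^sup>* T T'"
  shows steps_lam: "(step m)\<^sup>*\<^sup>* (Lam T) (Lam T')"
    and steps_appL: "(step m)\<^sup>*\<^sup>* (App T S) (App T' S)"
    and steps_appR: "(step m)\<^sup>*\<^sup>* (App S T) (App S T')"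
    and steps_bang: "(step (Suc m))\<^sup>*\<^sup>* (Bang T) (Bang T')"
    and steps_lift: "(step m)\<^sup>*\<^sup>* (lift k T) (lift k T')"
    and steps_subst: "(step m)\<^sup>*\<^sup>* (subst T U k) (subst T' U k)"
  using assms
  by (induction; meson rtranclp.rtrancl_refl rtranclp.rtrancl_into_rtrancl step.intros
        step_lift step_subst)+

section \<open>Parallel steps from a given level upwards\<close>

text \<open>
  The truncated subtraction is intended: once inside \<open>m\<close> bangs, every redex may be contracted.
\<close>

inductive par :: "nat \<Rightarrow> bterm \<Rightarrow> bterm \<Rightarrow> bool" where
  pvar: "par m (Var i) (Var i)"
| plam: "par m T T' \<Longrightarrow> par m (Lam T) (Lam T')"
| papp: "par m T T' \<Longrightarrow> par m S S' \<Longrightarrow> par m (App T S) (App T' S')"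
| pbang: "par (m - 1) T T' \<Longrightarrow> par m (Bang T) (Bang T')"
| pbeta: "par 0 T T' \<Longrightarrow> par 0 S S' \<Longrightarrow> par 0 (App (Lam T) (Bang S)) (subst T' S' 0)"

inductive_cases par_toLamE: "par m T (Lam U)"
inductive_cases par_toAppE: "par m T (App U V)"
inductive_cases par_toBangE: "par m T (Bang U)"
inductive_cases par_LamE: "par m (Lam U) T"
inductive_cases par_AppE: "par m (App U V) T"
inductive_cases par_BangE: "par m (Bang U) T"

lemma pbang_0: "par 0 T T' \<Longrightarrow> par 0 (Bang T) (Bang T')"
  by (rule par.pbang) simp

lemma pbang_Suc: "par m T T' \<Longrightarrow> par (Suc m) (Bang T) (Bang T')"
  by (rule par.pbang) simp

lemma par_refl: "par m T T"
  by (induction T arbitrary: m) (auto intro: par.intros)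

lemma par_antimono: "par m T U \<Longrightarrow> j \<le> m \<Longrightarrow> par j T U"
  by (induction arbitrary: j rule: par.induct) (auto intro: par.intros diff_le_mono)

lemma step_par: "step m T U \<Longrightarrow> par m T U"
  by (induction rule: step.induct) (auto intro: par.intros par_refl)

lemma par_lift: "par m T T' \<Longrightarrow> par m (lift k T) (lift k T')"
proof (induction arbitrary: k rule: par.induct)
  case (pbeta T T' S S')
  then show ?case
    using par.pbeta[of "lift (k + 1) T" "lift (k + 1) T'" "lift k S" "lift k S'"]
    by (simp add: lift_subst)
qed (auto intro: par.intros)

lemma par_subst:
  "par m T T' \<Longrightarrow> par m S S' \<Longrightarrow> par m (subst T S k) (subst T' S' k)"
proof (induction arbitrary: k S S' rule: par.induct)
  case (pbang m T T')
  then have "par (m - 1) (subst T S k) (subst T' S' k)"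
    using par_antimono[of m S S' "m - 1"] by simp
  then show ?case by (simp add: par.pbang)
next
  case (pbeta T T' U U')
  then show ?case
    using par.pbeta[of "subst T (lift 0 S) (Suc k)" "subst T' (lift 0 S') (Suc k)"
        "subst U S k" "subst U' S' k"]
    by (simp add: subst_subst par_lift)
next
  case (plam m T T')
  then show ?case by (simp add: par.plam par_lift)
qed (auto intro: par.pvar par.papp)

text \<open>\<open>pbeta\<close> needs index 0, so the redex contracted in \<open>U\<close> is
  already present in \<open>T\<close> and can join the parallel step. Index 0 in the conclusion
  suffices later, as \<open>free_below 0\<close> holds of every term.\<close>

lemma par_Suc_step_merge: "step m U W \<Longrightarrow> par (Suc m) T U \<Longrightarrow> par 0 T W"
proof (induction arbitrary: T rule: step.induct)
  case (beta A B)
  then obtain A' B' where "T = App (Lam A') (Bang B')" "par 1 A' A" "par 0 B' B"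
    by (auto elim!: par_toAppE par_toLamE par_toBangE)
  then show ?case by (auto intro: par.pbeta par_antimono)
next
  case (lam m U U')
  from lam.prems show ?case
    by (rule par_toLamE) (auto intro: par.plam lam.IH)
next
  case (appL m U U' S)
  from appL.prems show ?case
    by (rule par_toAppE) (auto intro: par.papp appL.IH par_antimono[of "Suc m" _ S])
next
  case (appR m S S' U)
  from appR.prems show ?case
    by (rule par_toAppE) (auto intro: par.papp appR.IH par_antimono[of "Suc m" _ U])
next
  case (bang m U U')
  from bang.prems show ?case
    by (rule par_toBangE) (auto intro: pbang_0 bang.IH)
qed

text \<open>Passing fewer than \<open>m\<close> bangs leaves the index positive. This excludes
  \<open>pbeta\<close>, so only congruence rules act on the way down to the redex and at its
  root.\<close>

lemma par_preserves_low_redex: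
  "step j T V \<Longrightarrow> par m T U \<Longrightarrow> j < m \<Longrightarrow> \<exists>W. step j U W"
proof (induction arbitrary: U m rule: step.induct)
  case (beta A B)
  then show ?case
    by (auto elim!: par_AppE par_LamE par_BangE intro: step.intros)
next
  case (lam j T T')
  from lam.prems(1) show ?case
    by (rule par_LamE) (metis lam.IH lam.prems(2) step.lam)
next
  case (appL j T T' S)
  from appL.prems(1) show ?case
    by (rule par_AppE) (metis appL.IH appL.prems(2) step.appL, use appL.prems(2) in simp)
next
  case (appR j S S' T)
  from appR.prems(1) show ?case
    by (rule par_AppE) (metis appR.IH appR.prems(2) step.appR, use appR.prems(2) in simp)
next
  case (bang j T T')
  from bang.prems obtain T1 where "U = Bang T1" "par (m - 1) T T1" "j < m - 1"
    by (auto elim!: par_BangE)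
  then show ?case using bang.IH step.bang by metis
qed

text \<open>The same exclusion of \<open>pbeta\<close>, read from the target back to the
  source.\<close>

lemma par_reflects_low_redex:
  "step j U W \<Longrightarrow> par m T U \<Longrightarrow> j < m \<Longrightarrow> \<exists>V. step j T V"
proof (induction arbitrary: T m rule: step.induct)
  case (beta A B)
  then show ?case
    by (auto elim!: par_toAppE par_toLamE par_toBangE intro: step.intros)
next
  case (lam j U U')
  from lam.prems(1) show ?case
    by (rule par_toLamE) (metis lam.IH lam.prems(2) step.lam, use lam.prems(2) in simp)
next
  case (appL j U U' S)
  from appL.prems(1) show ?case
    by (rule par_toAppE) (metis appL.IH appL.prems(2) step.appL, use appL.prems(2) in simp)
next
  case (appR j S S' U)
  from appR.prems(1) show ?case
    by (rule par_toAppE) (metis appR.IH appR.prems(2) step.appR, use appR.prems(2) in simp)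
next
  case (bang j U U')
  from bang.prems obtain T1 where "T = Bang T1" "par (m - 1) T1 U" "j < m - 1"
    by (auto elim!: par_toBangE)
  then show ?case using bang.IH step.bang by metis
qed

lemma par_free_below: "par m T U \<Longrightarrow> free_below m T \<Longrightarrow> free_below m U"
  unfolding free_below_def normal_def using par_reflects_low_redex by blast

section \<open>Splitting off the lowest level\<close>

text \<open>Serves the beta case of \<open>par_split\<close>. Copies of \<open>B\<close> at level 0
  first take the level-0 steps to \<open>B1\<close>; copies under a bang of \<open>A\<close> are
  already above level 0 and take the whole parallel step to \<open>B'\<close>. Hence the two kinds
  of hypotheses on \<open>B\<close>.\<close>

lemma par_1_subst_split:
  assumes "par (Suc 0) A A'" "par 0 B B'" "(step 0)\<^sup>*\<^sup>* B B1" "par (Suc 0) B1 B'"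
  shows "\<exists>V. (step 0)\<^sup>*\<^sup>* (subst A B k) V \<and> par (Suc 0) V (subst A' B' k)"
  using assms
proof (induction "Suc 0" A A' arbitrary: k B B' B1 rule: par.induct)
  case (pvar i)
  then show ?case by (auto intro: par.pvar)
next
  case (plam T T')
  then have "\<exists>V. (step 0)\<^sup>*\<^sup>* (subst T (lift 0 B) (Suc k)) V \<and>
      par (Suc 0) V (subst T' (lift 0 B') (Suc k))"
    by (blast intro: par_lift steps_lift)
  then show ?case by (auto intro: par.plam steps_lam)
next
  case (papp T T' S S')
  obtain V where V: "(step 0)\<^sup>*\<^sup>* (subst T B k) V" "par (Suc 0) V (subst T' B' k)"
    using papp by blast
  obtain W where W: "(step 0)\<^sup>*\<^sup>* (subst S B k) W" "par (Suc 0) W (subst S' B' k)"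
    using papp by blast
  have "(step 0)\<^sup>*\<^sup>* (App (subst T B k) (subst S B k)) (App V W)"
    using steps_appL[OF V(1)] steps_appR[OF W(1)] by (rule rtranclp_trans)
  then show ?case using V W by (auto intro: par.papp)
next
  case (pbang T T')
  \<comment> \<open>Everything under the bang lies above level 0, so the source itself serves as
    \<open>V\<close>, in zero steps.\<close>
  then have "par (Suc 0) (subst (Bang T) B k) (subst (Bang T') B' k)"
    by (auto intro: pbang_Suc par_subst)
  then show ?case by auto
qed

lemma par_split: "par m T U \<Longrightarrow> \<exists>V. (step m)\<^sup>*\<^sup>* T V \<and> par (Suc m) V U"
proof (induction rule: par.induct)
  case (pvar m i)
  then show ?case by (auto intro: par.pvar)
next
  case (plam m T T')
  then show ?case by (auto intro: par.plam steps_lam)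
next
  case (papp m T T' S S')
  then obtain V W where *: "(step m)\<^sup>*\<^sup>* T V" "par (Suc m) V T'" "(step m)\<^sup>*\<^sup>* S W" "par (Suc m) W S'"
    by blast
  have "(step m)\<^sup>*\<^sup>* (App T S) (App V W)"
    using steps_appL[OF *(1)] steps_appR[OF *(3)] by (rule rtranclp_trans)
  then show ?case using * by (auto intro: par.papp)
next
  case (pbang m T T')
  show ?case
  proof (cases m)
    case 0
    \<comment> \<open>Again zero steps: redexes under the bang have level at least 1.\<close>
    then show ?thesis using pbang.hyps by (auto intro: pbang_Suc)
  next
    case (Suc j)
    then show ?thesis
      using pbang.IH by (metis diff_Suc_1 pbang_Suc steps_bang)
  qed
next
  case (pbeta A A' B B')
  then obtain A1 B1 where *: "(step 0)\<^sup>*\<^sup>* A A1" "par (Suc 0) A1 A'" "(step 0)\<^sup>*\<^sup>* B B1" "par (Suc 0) B1 B'"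
    by blast
  obtain V where V: "(step 0)\<^sup>*\<^sup>* (subst A1 B 0) V" "par (Suc 0) V (subst A' B' 0)"
    using par_1_subst_split[OF *(2) pbeta.hyps(2) *(3,4)] by blast
  \<comment> \<open>The root redex goes first: reductions in \<open>B\<close> lie under a bang and
    can be level-0 steps only after \<open>B\<close> is substituted.\<close>
  have "(step 0)\<^sup>*\<^sup>* (App (Lam A) (Bang B)) (subst A1 B 0)"
    using step.beta steps_subst[OF *(1)] by (rule converse_rtranclp_into_rtranclp)
  then show ?case using V by (meson rtranclp_trans)
qed

section \<open>Least-level normalizability along backward parallel steps\<close>

lemma steps_ll_steps:
  assumes "(step m)\<^sup>*\<^sup>* T U" "free_below m T"
  shows "ll_step\<^sup>*\<^sup>* T U \<and> free_below m U"
  using assms(1)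
proof induction
  case base
  then show ?case using assms(2) by blast
next
  case (step U V)
  then have "ll_step U V" by (auto simp: ll_step_iff)
  \<comment> \<open>A step at level \<open>m\<close> is a parallel step at \<open>m\<close>, which
    creates no redex below \<open>m\<close>.\<close>
  moreover have "free_below m V" using step by (blast intro: par_free_below step_par)
  ultimately show ?case using step.IH by (meson rtranclp.rtrancl_into_rtrancl)
qed

text \<open>Taken of the target of a parallel step, which stays fixed while the level is raised,
  this bounds how often it can be raised.\<close>

primrec bang_depth :: "bterm \<Rightarrow> nat" where
  "bang_depth (Var i) = 0"
| "bang_depth (Lam T) = bang_depth T"
| "bang_depth (App T S) = max (bang_depth T) (bang_depth S)"
| "bang_depth (Bang T) = Suc (bang_depth T)"

text \<open>The strict inequality persists under each bang and rules out index 0, hence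
  \<open>pbeta\<close>.\<close>

lemma par_above_bang_depth: "par m T U \<Longrightarrow> bang_depth U < m \<Longrightarrow> T = U"
  by (induction rule: par.induct) auto

text \<open>Lexicographic induction on \<open>k\<close> and the distance from \<open>m\<close> to
  the bang depth of \<open>U\<close>. After splitting off level \<open>m\<close>, either
  \<open>V\<close> has no redex there and \<open>m\<close> is raised, or such a redex survives in
  \<open>U\<close> and the first least-level step of \<open>U\<close> is merged into the parallel
  step, which lowers \<open>k\<close>.\<close>

lemma par_ll_normalizing:
  assumes "(ll_step ^^ k) U N" "normal bang_step N" "par m T U" "free_below m T"
  shows "\<exists>N. ll_step\<^sup>*\<^sup>* T N \<and> normal bang_step N"
  using assms
proof (induction k arbitrary: U m T rule: less_induct)
  case (less k)
  show ?case
    using less.prems(3,4)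
  proof (induction "Suc (bang_depth U) - m" arbitrary: m T rule: less_induct)
    case inner: less
    show ?case
    proof (cases "bang_depth U < m")
      case True
      then have "T = U" using inner.prems par_above_bang_depth by blast
      then show ?thesis using less.prems(1,2) by (auto dest: relpowp_imp_rtranclp)
    next
      case False
      obtain V where V: "(step m)\<^sup>*\<^sup>* T V" "par (Suc m) V U"
        using par_split inner.prems(1) by blast
      have TV: "ll_step\<^sup>*\<^sup>* T V" and fV: "free_below m V"
        using steps_ll_steps V(1) inner.prems(2) by blast+
      have "\<exists>N. ll_step\<^sup>*\<^sup>* V N \<and> normal bang_step N"
      proof (cases "normal (step m) V")
        case True
        \<comment> \<open>Since \<open>m \<le> bang_depth U\<close>, the inner measure drops when
          \<open>m\<close> is raised; the \<open>Suc\<close> in it covers equality.\<close>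
        then have "free_below (Suc m) V" using fV by (auto simp: free_below_def less_Suc_eq)
        then show ?thesis using inner.hyps[OF _ V(2)] False by auto
      next
        case nV: False
        then obtain W' where W': "step m U W'"
          using par_preserves_low_redex[OF _ V(2)] by (auto simp: normal_def)
        then have "\<not> normal bang_step U" by (auto simp: normal_def bang_step_iff)
        then obtain k' where k: "k = Suc k'"
          using less.prems(1,2) by (cases k) auto
        obtain W where W: "ll_step U W" "(ll_step ^^ k') W N"
          using less.prems(1) unfolding k by (metis relpowp_Suc_E2)
        obtain i where i: "step i U W" "free_below i U"
          using W(1) by (auto simp: ll_step_iff)
        \<comment> \<open>The least level of \<open>U\<close> is exactly \<open>m\<close>:
          \<open>W'\<close> witnesses a redex there, and \<open>U\<close> inherits
          \<open>free_below m\<close> from \<open>V\<close>.\<close>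
        have "i \<le> m"
          using i(2) W' by (force simp: free_below_def normal_def not_le[symmetric])
        moreover have "free_below m U"
          using par_free_below[OF par_antimono[OF V(2)] fV] by simp
        ultimately have "i = m"
          using i(1) by (auto simp: free_below_def normal_def le_less)
        \<comment> \<open>The merged step restarts at level 0, where freeness is vacuous, with a
          shorter reduction from \<open>W\<close>.\<close>
        then have "par 0 V W" using par_Suc_step_merge i(1) V(2) by blast
        then show ?thesis
          using less.IH[OF _ W(2) less.prems(2)] k by (simp add: free_below_def)
      qed
      then show ?thesis using TV by (meson rtranclp_trans)
    qed
  qed
qed

text \<open>Works backwards from the normal form: each step is a parallel step at level 0.\<close>

lemma ll_normalizing:
  assumes "bang_step\<^sup>*\<^sup>* T U" "normal bang_step U"
  shows "\<exists>k N. (ll_step ^^ k) T N \<and> normal bang_step N"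
  using assms
proof (induction rule: converse_rtranclp_induct)
  case base
  then show ?case by (metis relpowp_0_I)
next
  case (step T V)
  then obtain k N where "(ll_step ^^ k) V N" "normal bang_step N" by blast
  moreover have "par 0 T V"
    using step.hyps(1) par_antimono[OF step_par] by (auto simp: bang_step_iff)
  ultimately show ?case
    using par_ll_normalizing[of k V N 0 T] by (auto simp: free_below_def rtranclp_power)
qed

section \<open>Random descent\<close>

text \<open>Both steps are at the least level of \<open>T\<close>, and the closing steps stay
  least-level because no lower redex is created.\<close>

lemma ll_step_diamond:
  assumes "ll_step T U" "ll_step T V" "U \<noteq> V"
  shows "\<exists>W. ll_step U W \<and> ll_step V W"
proof -
  obtain m j where m: "step m T U" "free_below m T" and j: "step j T V" "free_below j T"
    using assms by (auto simp: ll_step_iff)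
  then have "m = j"
    by (auto simp: free_below_def normal_def not_less_iff_gr_or_eq intro: linorder_cases[of m j])
  then show ?thesis
    using step_diamond[OF m(1)] j assms(3) m par_free_below step_par
    by (metis ll_step_iff)
qed

text \<open>Newman's random descent: peaks close in exactly one step on each side, so the distance
  to the normal form does not depend on the choice of steps.\<close>

lemma ll_random_descent:
  assumes "(ll_step ^^ Suc k) T N" "normal ll_step N" "ll_step T V"
  shows "(ll_step ^^ k) V N"
  using assms
proof (induction k arbitrary: T V)
  case 0
  then have "ll_step T N" by (metis One_nat_def relpowp_1)
  \<comment> \<open>Otherwise the diamond would give a step out of the normal form
    \<open>N\<close>.\<close>
  then have "V = N" using ll_step_diamond 0 by (metis normal_def)
  then show ?case by simp
next
  case (Suc k)
  obtain U where U: "ll_step T U" "(ll_step ^^ Suc k) U N"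
    using Suc.prems(1) by (metis relpowp_Suc_E2)
  show ?case
  proof (cases "U = V")
    case True
    then show ?thesis using U by simp
  next
    case False
    then obtain W where W: "ll_step U W" "ll_step V W"
      using ll_step_diamond U(1) Suc.prems(3) by blast
    have "(ll_step ^^ k) W N" using Suc.IH U(2) Suc.prems(2) W(1) by blast
    then show ?thesis using W(2) by (rule relpowp_Suc_I2[rotated])
  qed
qed

lemma ll_maximal_red_seq_finite:
  assumes "(ll_step ^^ k) (s 0) N" "normal bang_step N" "maximal_red_seq ll_step s n"
  shows "\<exists>j. n = enat j \<and> normal bang_step (s j)"
proof -
  have N: "normal ll_step N" using assms(2) by (simp add: normal_ll_step_iff)
  have st: "ll_step (s i) (s (Suc i))" if "enat i < n" for i
    using assms(3) that by (simp add: maximal_red_seq_def red_seq_def)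
  \<comment> \<open>Every step brings the sequence exactly one closer to \<open>N\<close>, so at
    most \<open>k\<close> steps fit.\<close>
  have descent: "i \<le> k \<and> (ll_step ^^ (k - i)) (s i) N" if "enat i \<le> n" for i
    using that
  proof (induction i)
    case 0
    then show ?case using assms(1) by simp
  next
    case (Suc i)
    then have lt: "enat i < n" by (simp add: Suc_ile_eq)
    then have IH: "i \<le> k" "(ll_step ^^ (k - i)) (s i) N" using Suc.IH by auto
    have "k \<noteq> i" using IH(2) N st[OF lt] by (auto simp: normal_def)
    then have "i < k" "k - i = Suc (k - Suc i)" using IH(1) by auto
    then show ?case using ll_random_descent[OF _ N st[OF lt]] IH(2) by auto
  qed
  \<comment> \<open>An infinite sequence would reach index \<open>Suc k\<close>, contradicting the
    bound \<open>k\<close>.\<close>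
  obtain j where "n = enat j"
    using descent[of "Suc k"] by (cases n) auto
  moreover from this have "normal ll_step (s j)"
    using assms(3) by (simp add: maximal_red_seq_def normal_def)
  ultimately show ?thesis by (simp add: normal_ll_step_iff)
qed

theorem theorem3: "normalizing_strategy ll_step bang_step"
  unfolding normalizing_strategy_def
proof (intro conjI allI impI)
  show "bang_step x y" if "ll_step x y" for x y
    using that by (auto simp: ll_step_iff bang_step_iff)
  show "normal ll_step x \<longleftrightarrow> normal bang_step x" for x
    by (rule normal_ll_step_iff)
  show "\<exists>k. n = enat k \<and> normal bang_step (s k)"
    if "bang_step\<^sup>*\<^sup>* x u \<and> normal bang_step u" "s 0 = x \<and> maximal_red_seq ll_step s n"
    for x u s n
    using that ll_normalizing ll_maximal_red_seq_finite by metis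
qed

end
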